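(* Let $X$ be a minimal shift space on a finite alphabet $A$ with an ergodic measure $\mu$ and let $\varphi\colon A^*\to G$ be a (monoid) morphism onto a finite group $G$ with uniform probability measure $\nu$. Suppose that $\nu\times\mu$ is ergodic on each of the minimal closed invariant subsets of $G\rtimes_\varphi X$. Then for every group language $L=\varphi^{-1}(K)$, where $K\subseteq G$, the density $\delta_\mu(L)$ is given by the following formula, where $\alpha\colon X\to H\backslash G$ is any minimal cobounding map: $$\delta_\mu(L)=\frac1{|H|}\sum_{k\in K}\ \sum_{Hg\in H\backslash G}\mu(\alpha^{-1}(Hg))\,\mu(\alpha^{-1}(Hgk)).$$
   Context: A shift space on a finite alphabet $A$ is a nonempty closed subset $X\subseteq A^{\mathbb Z}$ invariant under the shift map $S((x_n)_n)=(x_{n+1})_n$, such that every letter of $A$ occurs in some element of $X$; it is minimal if it has no proper nonempty closed shift-invariant subset. Write $x_{[i,j)}=x_i\cdots x_{j-1}$. Measures are Borel probability measures; an ergodic measure on $X$ is shift-invariant and ergodic. The density of $L\subseteq A^*$ is $\delta_\mu(L)=\lim_{n\to\infty}\frac1n\sum_{i=0}^{n-1}\mu(\{x\in X:x_{[0,i)}\in L\})$. The skew product $G\rtimes_\varphi X$ is the dynamical system $(G\times X,T_\varphi)$, $G$ discrete, with $T_\varphi(g,x)=(g\varphi(x_0),Sx)$. A minimal closed invariant subset is a nonempty closed $T_\varphi$-invariant subset with no proper nonempty closed $T_\varphi$-invariant subset (these have positive $\nu\times\mu$-measure). "$\nu\times\mu$ is ergodic on $Y$" means the normalized restriction of $\nu\times\mu$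 to $Y$ is ergodic for $T_\varphi$. For a subgroup $H\le G$, $H\backslash G$ is the set of right cosets $Hg$ (discrete, with right action of $G$). A cobounding map (for $\varphi$ on $X$, mod $H$) is a continuous map $\alpha\colon X\to H\backslash G$ with $\alpha(Sx)=\alpha(x)\varphi(x_0)$ for all $x\in X$. For cobounding maps $\alpha$ mod $H$ and $\beta$ mod $K'$, write $\alpha\le\beta$ if $H\le K'$ and $\alpha^{-1}(Hg)\subseteq\beta^{-1}(K'g)$ for all $g\in G$. A cobounding map is minimal if it is minimal for this partial order among all cobounding maps (over all subgroups of $G$). *)

theory Defs
  imports "HOL-Probability.Probability" "HOL-Algebra.Coset"
begin

text \<open>Invariance of a closed set is \<open>f ` Y = Y\<close>. All maps below are homeomorphisms of compact
  spaces, where minimality does not change if \<open>f ` Y \<subseteq> Y\<close> is used instead.\<close>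

definition closed_invariant :: "'x topology \<Rightarrow> ('x \<Rightarrow> 'x) \<Rightarrow> 'x set \<Rightarrow> bool" where
  "closed_invariant T f Y \<longleftrightarrow> Y \<noteq> {} \<and> closedin T Y \<and> f ` Y = Y"

definition minimal_closed_invariant :: "'x topology \<Rightarrow> ('x \<Rightarrow> 'x) \<Rightarrow> 'x set \<Rightarrow> bool" where
  "minimal_closed_invariant T f Y \<longleftrightarrow>
     closed_invariant T f Y \<and> (\<forall>Z. closed_invariant T f Z \<and> Z \<subseteq> Y \<longrightarrow> Z = Y)"

definition ergodic_measure :: "('x \<Rightarrow> 'x) \<Rightarrow> 'x measure \<Rightarrow> bool" where
  "ergodic_measure f M \<longleftrightarrow>
     prob_space M \<and> f \<in> measurable M M \<and> distr M M f = M \<and>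
     (\<forall>B\<in>sets M. f -` B \<inter> space M = B \<longrightarrow> measure M B = 0 \<or> measure M B = 1)"

definition full_shift :: "'a set \<Rightarrow> (int \<Rightarrow> 'a) topology" where
  "full_shift A = product_topology (\<lambda>_. discrete_topology A) UNIV"

definition shift_map :: "(int \<Rightarrow> 'a) \<Rightarrow> int \<Rightarrow> 'a" where
  "shift_map x = (\<lambda>n. x (n + 1))"

definition shift_space :: "'a set \<Rightarrow> (int \<Rightarrow> 'a) set \<Rightarrow> bool" where
  "shift_space A X \<longleftrightarrow>
     finite A \<and> closed_invariant (full_shift A) shift_map X \<and> (\<forall>a\<in>A. \<exists>x\<in>X. \<exists>n. x n = a)"

definition minimal_shift_space :: "'a set \<Rightarrow> (int \<Rightarrow> 'a) set \<Rightarrow> bool" where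
  "minimal_shift_space A X \<longleftrightarrow>
     shift_space A X \<and> minimal_closed_invariant (full_shift A) shift_map X"

definition shift_topology :: "'a set \<Rightarrow> (int \<Rightarrow> 'a) set \<Rightarrow> (int \<Rightarrow> 'a) topology" where
  "shift_topology A X = subtopology (full_shift A) X"

definition borel_measure_on :: "'x topology \<Rightarrow> 'x measure \<Rightarrow> bool" where
  "borel_measure_on T M \<longleftrightarrow>
     space M = topspace T \<and> sets M = sigma_sets (topspace T) {U. openin T U}"

definition ergodic_shift_measure ::
    "'a set \<Rightarrow> (int \<Rightarrow> 'a) set \<Rightarrow> (int \<Rightarrow> 'a) measure \<Rightarrow> bool" where
  "ergodic_shift_measure A X \<mu> \<longleftrightarrow>
     borel_measure_on (shift_topology A X) \<mu> \<and> ergodic_measure shift_map \<mu>"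

text \<open>\<open>factor x i j\<close> is the word \<open>x\<^sub>i \<dots> x\<^sub>j\<^sub>-\<^sub>1\<close>, empty if \<open>j \<le> i\<close>.\<close>

definition factor :: "(int \<Rightarrow> 'a) \<Rightarrow> int \<Rightarrow> int \<Rightarrow> 'a list" where
  "factor x i j = map x [i..j - 1]"

text \<open>The limit is part of the notion: \<open>has_language_density \<mu> L d\<close> says that the averages
  converge, with limit \<open>d\<close>.\<close>

definition has_language_density ::
    "(int \<Rightarrow> 'a) measure \<Rightarrow> 'a list set \<Rightarrow> real \<Rightarrow> bool" where
  "has_language_density \<mu> L d \<longleftrightarrow>
     (\<lambda>n. 1 / real n * (\<Sum>i<n. measure \<mu> {x \<in> space \<mu>. factor x 0 (int i) \<in> L})) \<longlonglongrightarrow> d"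

text \<open>A homomorphism in the sense of \<^const>\<open>hom\<close> from this monoid to a group preserves the
  neutral element automatically.\<close>

definition free_monoid :: "'a set \<Rightarrow> 'a list monoid" where
  "free_monoid A = \<lparr>carrier = lists A, mult = (@), one = []\<rparr>"

definition skew_topology ::
    "('g, 'm) monoid_scheme \<Rightarrow> 'a set \<Rightarrow> (int \<Rightarrow> 'a) set \<Rightarrow> ('g \<times> (int \<Rightarrow> 'a)) topology" where
  "skew_topology G A X = prod_topology (discrete_topology (carrier G)) (shift_topology A X)"

definition skew_map ::
    "('g, 'm) monoid_scheme \<Rightarrow> ('a list \<Rightarrow> 'g) \<Rightarrow> 'g \<times> (int \<Rightarrow> 'a) \<Rightarrow> 'g \<times> (int \<Rightarrow> 'a)" where
  "skew_map G \<phi> = (\<lambda>(g, x). (g \<otimes>\<^bsub>G\<^esub> \<phi> [x 0], shift_map x))"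

text \<open>\<^const>\<open>uniform_measure\<close> is the normalized restriction, as a measure on the whole space
  that is concentrated on the given set.\<close>

definition ergodic_on :: "('x \<Rightarrow> 'x) \<Rightarrow> 'x measure \<Rightarrow> 'x set \<Rightarrow> bool" where
  "ergodic_on f M Y \<longleftrightarrow> ergodic_measure f (uniform_measure M Y)"

text \<open>The right action of \<open>G\<close> on the right cosets of \<open>H\<close> is \<open>C #>\<^bsub>G\<^esub> g\<close>.\<close>

definition cobounding_map ::
    "('g, 'm) monoid_scheme \<Rightarrow> 'a set \<Rightarrow> (int \<Rightarrow> 'a) set \<Rightarrow> ('a list \<Rightarrow> 'g) \<Rightarrow>
     'g set \<Rightarrow> ((int \<Rightarrow> 'a) \<Rightarrow> 'g set) \<Rightarrow> bool" where
  "cobounding_map G A X \<phi> H \<alpha> \<longleftrightarrow>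
     subgroup H G \<and>
     continuous_map (shift_topology A X) (discrete_topology (rcosets\<^bsub>G\<^esub> H)) \<alpha> \<and>
     (\<forall>x\<in>X. \<alpha> (shift_map x) = \<alpha> x #>\<^bsub>G\<^esub> \<phi> [x 0])"

definition cobounding_le ::
    "('g, 'm) monoid_scheme \<Rightarrow> (int \<Rightarrow> 'a) set \<Rightarrow>
     'g set \<Rightarrow> ((int \<Rightarrow> 'a) \<Rightarrow> 'g set) \<Rightarrow> 'g set \<Rightarrow> ((int \<Rightarrow> 'a) \<Rightarrow> 'g set) \<Rightarrow> bool" where
  "cobounding_le G X H \<alpha> H' \<beta> \<longleftrightarrow>
     H \<subseteq> H' \<and>
     (\<forall>g\<in>carrier G. {x \<in> X. \<alpha> x = H #>\<^bsub>G\<^esub> g} \<subseteq> {x \<in> X. \<beta> x = H' #>\<^bsub>G\<^esub> g})"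

text \<open>Cobounding maps are functions on \<open>X\<close>, so two of them are identified when they agree
  on \<open>X\<close>.\<close>

definition minimal_cobounding_map ::
    "('g, 'm) monoid_scheme \<Rightarrow> 'a set \<Rightarrow> (int \<Rightarrow> 'a) set \<Rightarrow> ('a list \<Rightarrow> 'g) \<Rightarrow>
     'g set \<Rightarrow> ((int \<Rightarrow> 'a) \<Rightarrow> 'g set) \<Rightarrow> bool" where
  "minimal_cobounding_map G A X \<phi> H \<alpha> \<longleftrightarrow>
     cobounding_map G A X \<phi> H \<alpha> \<and>
     (\<forall>H' \<beta>. cobounding_map G A X \<phi> H' \<beta> \<and> cobounding_le G X H' \<beta> H \<alpha> \<longrightarrow>
        H' = H \<and> (\<forall>x\<in>X. \<beta> x = \<alpha> x))"

end

theory Submission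
  imports Defs
begin

text \<open>
  The graph \<open>Y = {(g, x). g \<in> \<alpha> x}\<close> of a cobounding map \<open>\<alpha>\<close> is a closed invariant subset of the
  skew product. Conversely, left translation by \<open>G\<close> commutes with the skew map, so the fibres of a
  minimal closed invariant set \<open>Z\<close> are right cosets of its left stabilizer and \<open>Z\<close> is the graph of
  a cobounding map. Hence minimality of \<open>\<alpha>\<close> makes \<open>Y\<close> minimal, so the normalized restriction \<open>m\<close> of
  \<open>\<nu> \<times> \<mu>\<close> to \<open>Y\<close> is ergodic. On \<open>\<alpha> x = Hg\<close>, the word \<open>x\<^sub>0 \<dots> x\<^sub>i\<^sub>-\<^sub>1\<close> has image \<open>k\<close> iff \<open>i\<close> steps of
  the skew map lead from \<open>(g, x)\<close> to the fibre over \<open>gk\<close>, so the density is a sum of limits of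
  averages of \<open>m (E \<inter> T\<^sup>-\<^sup>i F)\<close>, which equal \<open>m E * m F\<close> by Birkhoff's theorem.
\<close>

subsection \<open>Birkhoff averages of bounded functions\<close>

text \<open>This is the maximum of the partial sums \<open>(\<Sum>i<j. f ((T ^^ i) x))\<close> over
  \<open>j \<le> n\<close>, including the empty one. The recursion along \<open>T\<close> is chosen
  as definition because it is the identity that the maximal ergodic argument uses.\<close>

primrec max_birkhoff_sum :: "('x \<Rightarrow> 'x) \<Rightarrow> ('x \<Rightarrow> real) \<Rightarrow> nat \<Rightarrow> 'x \<Rightarrow> real" where
  "max_birkhoff_sum T f 0 x = 0"
| "max_birkhoff_sum T f (Suc n) x = max 0 (f x + max_birkhoff_sum T f n (T x))"

lemma max_birkhoff_sum_nonneg: "0 \<le> max_birkhoff_sum T f n x"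
  by (cases n) auto

lemma max_birkhoff_sum_Suc_ge: "max_birkhoff_sum T f n x \<le> max_birkhoff_sum T f (Suc n) x"
proof (induction n arbitrary: x)
  case (Suc n)
  show ?case using Suc[of "T x"] by auto
qed auto

lemma birkhoff_sum_le_max: "(\<Sum>i<n. f ((T ^^ i) x)) \<le> max_birkhoff_sum T f n x"
proof (induction n arbitrary: x)
  case (Suc n)
  have "(\<Sum>i<Suc n. f ((T ^^ i) x)) = f x + (\<Sum>i<n. f ((T ^^ i) (T x)))"
    by (simp add: sum.lessThan_Suc_shift funpow_swap1 del: sum.lessThan_Suc)
  then show ?case using Suc[of "T x"] by simp
qed auto

lemma ergodic_measure_prob_space: "ergodic_measure T M \<Longrightarrow> prob_space M"
  and ergodic_measure_measurable: "ergodic_measure T M \<Longrightarrow> T \<in> measurable M M"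
  and ergodic_measure_distr: "ergodic_measure T M \<Longrightarrow> distr M M T = M"
  by (simp_all add: ergodic_measure_def)

lemma funpow_measurable:
  assumes "T \<in> measurable M M"
  shows "T ^^ n \<in> measurable M M"
proof (induction n)
  case (Suc n)
  then show ?case using measurable_compose[OF Suc assms] by (simp add: comp_def)
qed (simp add: measurable_ident id_def)

lemma max_birkhoff_sum_measurable:
  assumes "T \<in> measurable M M" "f \<in> borel_measurable M"
  shows "max_birkhoff_sum T f n \<in> borel_measurable M"
proof (induction n)
  case 0
  then show ?case by simp
next
  case (Suc n)
  have "(\<lambda>x. max_birkhoff_sum T f n (T x)) \<in> borel_measurable M"
    by (rule measurable_compose[OF assms(1) Suc])
  then show ?case using assms(2) by simp
qed

lemma max_birkhoff_sum_le:
  fixes f :: "'x \<Rightarrow> real"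
  assumes "T \<in> space M \<rightarrow> space M" "\<And>x. x \<in> space M \<Longrightarrow> \<bar>f x\<bar> \<le> c" "0 \<le> c" "x \<in> space M"
  shows "max_birkhoff_sum T f n x \<le> real n * c"
  using assms(4)
proof (induction n arbitrary: x)
  case (Suc n)
  have "max_birkhoff_sum T f n (T x) \<le> real n * c" "f x \<le> c"
    using Suc assms(1) assms(2)[of x] by (auto simp: abs_le_iff)
  then show ?case using assms(3) by (simp add: algebra_simps)
qed auto

text \<open>Let \<open>P\<^sub>n\<close> be the maximal Birkhoff sums. Then \<open>P\<^sub>n\<^sub>+\<^sub>1 - P\<^sub>n \<circ> T\<close> has nonnegative integral, because
  \<open>P\<^sub>n\<close> is increasing and \<open>T\<close> preserves the measure, but it converges to \<open>f\<close> where \<open>P\<^sub>n\<close> is unbounded.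
  As \<open>f\<close> has negative integral, the invariant set of these points has measure \<open>0\<close>.\<close>

lemma ergodic_birkhoff_sums_bounded_above:
  fixes f :: "'x \<Rightarrow> real"
  assumes erg: "ergodic_measure T M" and f: "f \<in> borel_measurable M"
    and bd: "\<And>x. x \<in> space M \<Longrightarrow> \<bar>f x\<bar> \<le> c" and neg: "(\<integral>x. f x \<partial>M) < 0"
  shows "AE x in M. \<exists>b. \<forall>n. (\<Sum>i<n. f ((T ^^ i) x)) \<le> b"
proof -
  interpret prob_space M by (rule ergodic_measure_prob_space[OF erg])
  note T = ergodic_measure_measurable[OF erg]
  define P where "P = max_birkhoff_sum T f"
  define D where "D = {x \<in> space M. \<forall>b::nat. \<exists>n. P n x > real b}"
  have Pm[measurable]: "P n \<in> borel_measurable M" for n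
    unfolding P_def by (rule max_birkhoff_sum_measurable[OF T f])
  have Tsp: "T x \<in> space M" if "x \<in> space M" for x
    using measurable_space[OF T that] .
  have c0: "0 \<le> c" using bd not_empty by (meson abs_ge_zero ex_in_conv order_trans)
  have Dm: "D \<in> sets M" unfolding D_def by measurable
  have Pmono: "P n x \<le> P m x" if "n \<le> m" for n m x
    using lift_Suc_mono_le[of "\<lambda>n. P n x", OF _ that] by (simp add: P_def max_birkhoff_sum_Suc_ge del: max_birkhoff_sum.simps)
  have PSuc: "P (Suc n) x = max 0 (f x + P n (T x))" for n x by (simp add: P_def)
  have P0: "0 \<le> P n x" for n x by (simp add: P_def max_birkhoff_sum_nonneg)
  \<comment> \<open>Up to truncation at \<open>0\<close>, \<open>P (Suc n) x\<close> and
    \<open>P n (T x)\<close> differ only by \<open>f x\<close>, so they are unbounded together. The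
    summand \<open>nat \<lceil>c\<rceil>\<close> absorbs that term.\<close>
  have "T x \<in> D \<longleftrightarrow> x \<in> D" if x: "x \<in> space M" for x
  proof
    assume d: "T x \<in> D"
    have "\<exists>n. P n x > real b" for b :: nat
    proof -
      obtain n where "P n (T x) > real (b + nat \<lceil>c\<rceil>)" using d unfolding D_def by blast
      then have "P (Suc n) x > real b" using bd[OF x] PSuc[of n x] by linarith
      then show ?thesis by blast
    qed
    then show "x \<in> D" using x by (simp add: D_def)
  next
    assume d: "x \<in> D"
    have "\<exists>n. P n (T x) > real b" for b :: nat
    proof -
      obtain n where n: "P n x > real (b + nat \<lceil>c\<rceil>)" using d unfolding D_def by blast
      have "P n x \<le> P (Suc n) x" by (rule Pmono) simp
      then have "P n (T x) > real b" using n bd[OF x] PSuc[of n x] by linarith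
      then show ?thesis by blast
    qed
    then show "T x \<in> D" using Tsp[OF x] by (simp add: D_def)
  qed
  then have "T -` D \<inter> space M = D" by (auto simp: D_def)
  then have "prob D = 0 \<or> prob D = 1" using erg Dm by (auto simp: ergodic_measure_def)
  moreover have "prob D \<noteq> 1"
  proof
    assume "prob D = 1"
    then have aeD: "AE x in M. x \<in> D" using prob_eq_1[OF Dm] by simp
    \<comment> \<open>\<open>g n\<close> equals \<open>P (Suc n)\<close> minus \<open>P n\<close>
      composed with \<open>T\<close>. Written as a maximum it is visibly bounded by \<open>c\<close>
      uniformly in \<open>n\<close>, as dominated convergence requires.\<close>
    define g where "g = (\<lambda>n x. max (- P n (T x)) (f x))"
    have PTm[measurable]: "(\<lambda>x. P n (T x)) \<in> borel_measurable M" for n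
      by (rule measurable_compose[OF T Pm])
    have gm[measurable]: "g n \<in> borel_measurable M" for n
      unfolding g_def using f by measurable
    have gbd: "\<bar>g n x\<bar> \<le> c" if "x \<in> space M" for n x
      using bd[OF that] P0[of n "T x"] c0 unfolding g_def by auto
    have Pbd: "\<bar>P n x\<bar> \<le> real n * c" if "x \<in> space M" for n x
      using max_birkhoff_sum_le[of T M f c x n, OF _ bd c0 that] P0[of n x] Tsp
      by (auto simp: P_def)
    have Pint: "integrable M (P n)" for n
      by (rule integrable_const_bound[where B="real n * c"]) (use Pbd in auto)
    have PTint: "integrable M (\<lambda>x. P n (T x))" for n
      by (rule integrable_const_bound[where B="real n * c"]) (use Pbd Tsp in auto)
    have conv: "(\<lambda>n. \<integral>x. g n x \<partial>M) \<longlonglongrightarrow> (\<integral>x. f x \<partial>M)"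
    proof (rule integral_dominated_convergence[where w="\<lambda>_. c"])
      show "AE x in M. (\<lambda>n. g n x) \<longlonglongrightarrow> f x"
        using aeD
      proof (rule AE_mp, intro AE_I2 impI)
        fix x assume x: "x \<in> space M" and "x \<in> D"
        \<comment> \<open>Beyond \<open>2 * c\<close>, subtracting the term
          \<open>f x \<le> c\<close> still leaves \<open>P n (T x) \<ge> c\<close>. Then
          \<open>- P n (T x) \<le> f x\<close>, so the maximum in \<open>g\<close> is
          \<open>f x\<close>.\<close>
        then obtain n0 where n0: "P n0 x > real (nat \<lceil>2 * c\<rceil>)" unfolding D_def by blast
        have "g n x = f x" if "n \<ge> n0" for n
        proof -
          have "P n0 x \<le> P (Suc n) x" using that by (intro Pmono) simp
          then have "P n (T x) \<ge> c" using n0 bd[OF x] PSuc[of n x] c0 by linarith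
          then show ?thesis using bd[OF x] unfolding g_def by auto
        qed
        then show "(\<lambda>n. g n x) \<longlonglongrightarrow> f x"
          by (intro tendsto_eventually) (auto simp: eventually_sequentially)
      qed
    qed (use f gbd in auto)
    have "0 \<le> (\<integral>x. g n x \<partial>M)" for n
    proof -
      have "(\<integral>x. P n x \<partial>M) = (\<integral>x. P n x \<partial>distr M M T)"
        by (simp add: ergodic_measure_distr[OF erg])
      also have "\<dots> = (\<integral>x. P n (T x) \<partial>M)"
        by (rule integral_distr[OF T Pm])
      finally have e: "(\<integral>x. P n x \<partial>M) = (\<integral>x. P n (T x) \<partial>M)" .
      have "(\<integral>x. P n x \<partial>M) \<le> (\<integral>x. P (Suc n) x \<partial>M)"
        by (rule integral_mono[OF Pint Pint]) (rule Pmono, simp)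
      then have "0 \<le> (\<integral>x. P (Suc n) x - P n (T x) \<partial>M)"
        using e by (simp add: Pint PTint)
      also have "(\<lambda>x. P (Suc n) x - P n (T x)) = g n"
        by (auto simp: PSuc g_def)
      finally show ?thesis .
    qed
    then have "0 \<le> (\<integral>x. f x \<partial>M)" by (intro LIMSEQ_le_const[OF conv]) auto
    then show False using neg by simp
  qed
  ultimately have "prob D = 0" by blast
  then have "AE x in M. x \<notin> D" using prob_eq_0[OF Dm] by simp
  then show ?thesis
  proof (rule AE_mp, intro AE_I2 impI)
    fix x assume "x \<in> space M" "x \<notin> D"
    then obtain b :: nat where b: "P n x \<le> real b" for n unfolding D_def using not_le by blast
    have "(\<Sum>i<n. f ((T ^^ i) x)) \<le> real b" for n
      using birkhoff_sum_le_max[of f T x n] b[of n] by (simp add: P_def)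
    then show "\<exists>b. \<forall>n. (\<Sum>i<n. f ((T ^^ i) x)) \<le> b" by blast
  qed
qed

text \<open>With \<open>d\<close> the mean plus \<open>e / 2\<close>, the function
  \<open>f x - d\<close> has integral \<open>- e / 2\<close>, so its Birkhoff sums are almost
  everywhere bounded above by some \<open>b\<close>. Division by \<open>n\<close> makes
  \<open>b\<close> negligible.\<close>

lemma ergodic_birkhoff_average_le:
  fixes f :: "'x \<Rightarrow> real"
  assumes erg: "ergodic_measure T M" and f: "f \<in> borel_measurable M"
    and bd: "\<And>x. x \<in> space M \<Longrightarrow> \<bar>f x\<bar> \<le> c" and e: "0 < e"
  shows "AE x in M. \<forall>\<^sub>F n in sequentially.
    1 / real n * (\<Sum>i<n. f ((T ^^ i) x)) < (\<integral>x. f x \<partial>M) + e"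
proof -
  interpret prob_space M by (rule ergodic_measure_prob_space[OF erg])
  define d where "d = (\<integral>x. f x \<partial>M) + e / 2"
  have fint: "integrable M f" by (rule integrable_const_bound[where B=c]) (use bd f in auto)
  have "AE x in M. \<exists>b. \<forall>n. (\<Sum>i<n. f ((T ^^ i) x) - d) \<le> b"
  proof (rule ergodic_birkhoff_sums_bounded_above[OF erg])
    show "(\<lambda>x. f x - d) \<in> borel_measurable M" using f by simp
    show "\<bar>f x - d\<bar> \<le> c + \<bar>d\<bar>" if "x \<in> space M" for x using bd[OF that] by linarith
    show "(\<integral>x. f x - d \<partial>M) < 0" using fint e by (simp add: d_def prob_space)
  qed
  then show ?thesis
  proof (rule AE_mp, intro AE_I2 impI)
    fix x assume "\<exists>b. \<forall>n. (\<Sum>i<n. f ((T ^^ i) x) - d) \<le> b"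
    then obtain b where b: "(\<Sum>i<n. f ((T ^^ i) x)) \<le> b + real n * d" for n
      by (auto simp: sum_subtractf algebra_simps)
    have "(\<lambda>n. b / real n) \<longlonglongrightarrow> 0" by (rule lim_const_over_n)
    then have "\<forall>\<^sub>F n in sequentially. b / real n < e / 2" using e by (intro order_tendstoD(2)) auto
    then show "\<forall>\<^sub>F n in sequentially. 1 / real n * (\<Sum>i<n. f ((T ^^ i) x)) < (\<integral>x. f x \<partial>M) + e"
      using eventually_gt_at_top[of 0]
    proof eventually_elim
      case (elim n)
      have "1 / real n * (\<Sum>i<n. f ((T ^^ i) x)) \<le> 1 / real n * (b + real n * d)"
        by (intro mult_left_mono b) simp
      also have "\<dots> = b / real n + d" using elim(2) by (simp add: field_simps)
      finally show ?case using elim(1) unfolding d_def by linarith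
    qed
  qed
qed

text \<open>The one-sided estimate is applied to \<open>f\<close> and to \<open>- f\<close>. The
  error runs through the countably many values \<open>inverse (real (Suc m))\<close>, so that the
  exceptional sets have a null union.\<close>

lemma ergodic_birkhoff:
  fixes f :: "'x \<Rightarrow> real"
  assumes erg: "ergodic_measure T M" and f: "f \<in> borel_measurable M"
    and bd: "\<And>x. x \<in> space M \<Longrightarrow> \<bar>f x\<bar> \<le> c"
  shows "AE x in M. (\<lambda>n. 1 / real n * (\<Sum>i<n. f ((T ^^ i) x))) \<longlonglongrightarrow> (\<integral>x. f x \<partial>M)"
proof -
  let ?a = "\<lambda>x n. 1 / real n * (\<Sum>i<n. f ((T ^^ i) x))" and ?I = "\<integral>x. f x \<partial>M"
  have up: "AE x in M. \<forall>m. \<forall>\<^sub>F n in sequentially. ?a x n < ?I + inverse (real (Suc m))"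
    unfolding AE_all_countable
    by (intro allI ergodic_birkhoff_average_le[OF erg f bd]) auto
  have "AE x in M. \<forall>m. \<forall>\<^sub>F n in sequentially.
      1 / real n * (\<Sum>i<n. - f ((T ^^ i) x)) < (\<integral>x. - f x \<partial>M) + inverse (real (Suc m))"
    unfolding AE_all_countable
    by (intro allI ergodic_birkhoff_average_le[OF erg, where c=c]) (use f bd in auto)
  with up show ?thesis
  proof (eventually_elim)
    case (elim x)
    show ?case
    proof (rule order_tendstoI)
      fix a assume "a < ?I"
      then obtain m where m: "inverse (real (Suc m)) < ?I - a"
        using reals_Archimedean[of "?I - a"] by auto
      show "\<forall>\<^sub>F n in sequentially. a < ?a x n"
        using elim(2)[rule_format, of m]
        by eventually_elim (use m in \<open>simp add: sum_negf\<close>)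
    next
      fix a assume "?I < a"
      then obtain m where m: "inverse (real (Suc m)) < a - ?I"
        using reals_Archimedean[of "a - ?I"] by auto
      show "\<forall>\<^sub>F n in sequentially. ?a x n < a"
        using elim(1)[rule_format, of m]
        by eventually_elim (use m in simp)
    qed
  qed
qed

text \<open>Birkhoff averages of the indicator of \<open>F\<close> converge to
  \<open>measure M F\<close>. Integrating them over \<open>E\<close> gives the averages in question,
  and the bound \<open>1\<close> permits passing to the limit.\<close>

lemma ergodic_mean_correlation:
  assumes erg: "ergodic_measure T M" and E: "E \<in> sets M" and F: "F \<in> sets M"
  shows "(\<lambda>n. 1 / real n * (\<Sum>i<n. measure M (E \<inter> (T ^^ i) -` F)))
           \<longlonglongrightarrow> measure M E * measure M F"
proof -
  interpret prob_space M by (rule ergodic_measure_prob_space[OF erg])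
  note T = funpow_measurable[OF ergodic_measure_measurable[OF erg]]
  define h :: "nat \<Rightarrow> 'a \<Rightarrow> real" where
    "h n x = indicator E x * (1 / real n * (\<Sum>i<n. indicator F ((T ^^ i) x)))" for n x
  have im: "(\<lambda>x. indicator F ((T ^^ i) x) :: real) \<in> borel_measurable M" for i
    by (rule measurable_compose[OF T]) (use F in simp)
  have "AE x in M. (\<lambda>n. 1 / real n * (\<Sum>i<n. indicator F ((T ^^ i) x))) \<longlonglongrightarrow> (\<integral>x. indicator F x \<partial>M)"
    by (rule ergodic_birkhoff[OF erg, where c=1]) (use F in \<open>auto simp: indicator_def\<close>)
  then have ae: "AE x in M. (\<lambda>n. h n x) \<longlonglongrightarrow> indicator E x * measure M F"
  proof eventually_elim
    case (elim x)
    then show ?case using F unfolding h_def by (intro tendsto_mult_left) simp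
  qed
  have hb: "\<bar>h n x\<bar> \<le> 1" for n x
  proof -
    have "(\<Sum>i<n. indicator F ((T ^^ i) x) :: real) \<le> (\<Sum>i<n. 1)"
      by (intro sum_mono) (auto simp: indicator_def)
    moreover have "0 \<le> (\<Sum>i<n. indicator F ((T ^^ i) x) :: real)"
      by (intro sum_nonneg) auto
    \<comment> \<open>For \<open>n = 0\<close> the average is \<open>0\<close>, since division by
      zero gives zero.\<close>
    ultimately show ?thesis
      by (cases "n = 0") (auto simp: h_def indicator_def divide_simps)
  qed
  have "(\<lambda>n. \<integral>x. h n x \<partial>M) \<longlonglongrightarrow> (\<integral>x. indicator E x * measure M F \<partial>M)"
  proof (rule integral_dominated_convergence[where w="\<lambda>_. 1"])
    show "h n \<in> borel_measurable M" for n
      unfolding h_def using im E by measurable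
  qed (use ae hb E in auto)
  moreover have "(\<integral>x. h n x \<partial>M) = 1 / real n * (\<Sum>i<n. measure M (E \<inter> (T ^^ i) -` F))" for n
  proof -
    have s: "E \<inter> (T ^^ i) -` F \<in> sets M" for i
    proof -
      have "E \<inter> (T ^^ i) -` F = E \<inter> ((T ^^ i) -` F \<inter> space M)"
        using sets.sets_into_space[OF E] by auto
      then show ?thesis using measurable_sets[OF T F] E by auto
    qed
    have "h n = (\<lambda>x. 1 / real n * (\<Sum>i<n. indicator (E \<inter> (T ^^ i) -` F) x))"
      by (auto simp: h_def indicator_def sum_distrib_left fun_eq_iff)
    then have "(\<integral>x. h n x \<partial>M) = 1 / real n * (\<integral>x. (\<Sum>i<n. indicator (E \<inter> (T ^^ i) -` F) x) \<partial>M)"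
      by simp
    also have "(\<integral>x. (\<Sum>i<n. indicator (E \<inter> (T ^^ i) -` F) x) \<partial>M)
        = (\<Sum>i<n. measure M (E \<inter> (T ^^ i) -` F))"
      by (subst Bochner_Integration.integral_sum) (use s in \<open>auto simp: emeasure_eq_measure\<close>)
    finally show ?thesis .
  qed
  ultimately show ?thesis using E by simp
qed

subsection \<open>Minimal sets of the skew product\<close>

lemma shift_map_inj: "shift_map x = shift_map y \<Longrightarrow> x = y"
proof
  fix n assume "shift_map x = shift_map y"
  from fun_cong[OF this, of "n - 1"] show "x n = y n" by (simp add: shift_map_def)
qed

lemma factor_Suc: "factor x 0 (int (Suc n)) = factor x 0 (int n) @ [x (int n)]"
  using upto_rec2[of 0 "int n"] by (simp add: factor_def)

lemma funpow_shift_map: "(shift_map ^^ n) x = (\<lambda>i. x (i + int n))"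
  by (induction n) (auto simp: shift_map_def algebra_simps)

locale group_skew_product = group G for G (structure) +
  fixes A :: "'c set" and X :: "(int \<Rightarrow> 'c) set" and \<phi> :: "'c list \<Rightarrow> 'a"
  assumes finite_carrier: "finite (carrier G)"
    and minimal_shift: "minimal_shift_space A X"
    and hom_phi: "\<phi> \<in> hom (free_monoid A) G"
begin

abbreviation skew_closed_invariant :: "('a \<times> (int \<Rightarrow> 'c)) set \<Rightarrow> bool" where
  "skew_closed_invariant \<equiv> closed_invariant (skew_topology G A X) (skew_map G \<phi>)"

abbreviation skew_minimal :: "('a \<times> (int \<Rightarrow> 'c)) set \<Rightarrow> bool" where
  "skew_minimal \<equiv> minimal_closed_invariant (skew_topology G A X) (skew_map G \<phi>)"

lemma closedin_X: "closedin (full_shift A) X"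
  and shift_image_X: "shift_map ` X = X"
  and X_nonempty: "X \<noteq> {}"
  using minimal_shift
  by (auto simp: minimal_shift_space_def shift_space_def closed_invariant_def)

lemma X_letter: "x \<in> X \<Longrightarrow> x n \<in> A"
  using closedin_subset[OF closedin_X] by (auto simp: full_shift_def PiE_def Pi_def)

lemma shift_X: "x \<in> X \<Longrightarrow> shift_map x \<in> X"
  using shift_image_X by blast

lemma topspace_shift [simp]: "topspace (shift_topology A X) = X"
  using closedin_subset[OF closedin_X] by (auto simp: shift_topology_def)

lemma topspace_skew: "topspace (skew_topology G A X) = carrier G \<times> X"
  by (simp add: skew_topology_def)

lemma phi_closed: "w \<in> lists A \<Longrightarrow> \<phi> w \<in> carrier G"
  using hom_phi by (auto simp: hom_def free_monoid_def)

lemma phi_append: "v \<in> lists A \<Longrightarrow> w \<in> lists A \<Longrightarrow> \<phi> (v @ w) = \<phi> v \<otimes> \<phi> w"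
  using hom_phi by (auto simp: hom_def free_monoid_def)

text \<open>The predicate \<open>hom\<close> speaks of products only, but \<open>\<phi> []\<close>
  is idempotent, and in a group this forces it to be the neutral element.\<close>

lemma phi_Nil: "\<phi> [] = \<one>"
  using phi_append[of "[]" "[]"] phi_closed[of "[]"] by (simp add: l_cancel_one)

lemma phi_letter [simp]: "x \<in> X \<Longrightarrow> \<phi> [x n] \<in> carrier G"
  by (simp add: phi_closed X_letter)

lemma shift_minimality:
  assumes W: "closedin (shift_topology A X) W" "W \<noteq> {}"
    and inv: "\<And>x. x \<in> X \<Longrightarrow> shift_map x \<in> W \<longleftrightarrow> x \<in> W"
  shows "W = X"
proof -
  have WX: "W \<subseteq> X" using closedin_subset[OF W(1)] by simp
  have "closedin (full_shift A) W"
    using W(1) closedin_X by (simp add: shift_topology_def closedin_closed_subtopology)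
  moreover have "shift_map ` W = W"
  proof
    show "shift_map ` W \<subseteq> W" using inv WX by blast
    show "W \<subseteq> shift_map ` W"
    proof
      fix y assume "y \<in> W"
      moreover from this obtain x where "x \<in> X" "y = shift_map x" using WX shift_image_X by blast
      ultimately show "y \<in> shift_map ` W" using inv by blast
    qed
  qed
  ultimately have "closed_invariant (full_shift A) shift_map W"
    using W(2) by (simp add: closed_invariant_def)
  then show ?thesis using minimal_shift WX
    by (auto simp: minimal_shift_space_def minimal_closed_invariant_def)
qed

text \<open>The group carries the discrete topology, so slices of closed sets are closed. It is
  finite, so conversely \<open>Z\<close> is a finite union of closed sets
  \<open>{g} \<times> Z_g\<close>.\<close>

lemma closedin_skew_iff:
  assumes "Z \<subseteq> carrier G \<times> X"
  shows "closedin (skew_topology G A X) Z \<longleftrightarrow>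
    (\<forall>g\<in>carrier G. closedin (shift_topology A X) {x \<in> X. (g, x) \<in> Z})"
proof
  assume Z: "closedin (skew_topology G A X) Z"
  show "\<forall>g\<in>carrier G. closedin (shift_topology A X) {x \<in> X. (g, x) \<in> Z}"
  proof
    fix g assume g: "g \<in> carrier G"
    have "continuous_map (shift_topology A X) (skew_topology G A X) (\<lambda>x. (g, x))"
      unfolding skew_topology_def using g by (intro continuous_map_pairedI) auto
    from closedin_continuous_map_preimage[OF this Z]
    show "closedin (shift_topology A X) {x \<in> X. (g, x) \<in> Z}" by simp
  qed
next
  assume cl: "\<forall>g\<in>carrier G. closedin (shift_topology A X) {x \<in> X. (g, x) \<in> Z}"
  have "closedin (skew_topology G A X) (\<Union>g\<in>carrier G. {g} \<times> {x \<in> X. (g, x) \<in> Z})"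
    using cl finite_carrier
    by (intro closedin_Union) (auto simp: skew_topology_def closedin_prod_Times_iff)
  also have "(\<Union>g\<in>carrier G. {g} \<times> {x \<in> X. (g, x) \<in> Z}) = Z"
    using assms by auto
  finally show "closedin (skew_topology G A X) Z" .
qed

text \<open>The skew map is a bijection of \<open>carrier G \<times> X\<close>, so invariance can be
  tested point by point in both directions.\<close>

lemma skew_image_eq_iff:
  assumes "Z \<subseteq> carrier G \<times> X"
  shows "skew_map G \<phi> ` Z = Z \<longleftrightarrow>
    (\<forall>g\<in>carrier G. \<forall>x\<in>X. (g \<otimes> \<phi> [x 0], shift_map x) \<in> Z \<longleftrightarrow> (g, x) \<in> Z)"
proof
  assume im: "skew_map G \<phi> ` Z = Z"
  show "\<forall>g\<in>carrier G. \<forall>x\<in>X. (g \<otimes> \<phi> [x 0], shift_map x) \<in> Z \<longleftrightarrow> (g, x) \<in> Z"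
  proof (intro ballI iffI)
    fix g x assume gx: "g \<in> carrier G" "x \<in> X" and "(g \<otimes> \<phi> [x 0], shift_map x) \<in> Z"
    then have "(g \<otimes> \<phi> [x 0], shift_map x) \<in> skew_map G \<phi> ` Z" using im by simp
    then obtain h y where hy: "(h, y) \<in> Z" "h \<otimes> \<phi> [y 0] = g \<otimes> \<phi> [x 0]"
        "shift_map x = shift_map y"
      by (auto simp: skew_map_def)
    then have "y = x" using shift_map_inj by metis
    moreover have "h \<in> carrier G" using hy(1) assms by auto
    ultimately show "(g, x) \<in> Z" using hy gx by simp
  next
    fix g x assume "(g, x) \<in> Z"
    then have "skew_map G \<phi> (g, x) \<in> skew_map G \<phi> ` Z" by blast
    then show "(g \<otimes> \<phi> [x 0], shift_map x) \<in> Z" using im by (simp add: skew_map_def)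
  qed
next
  assume inv: "\<forall>g\<in>carrier G. \<forall>x\<in>X. (g \<otimes> \<phi> [x 0], shift_map x) \<in> Z \<longleftrightarrow> (g, x) \<in> Z"
  show "skew_map G \<phi> ` Z = Z"
  proof
    show "skew_map G \<phi> ` Z \<subseteq> Z" using inv assms by (auto simp: skew_map_def)
    show "Z \<subseteq> skew_map G \<phi> ` Z"
    proof
      fix p assume p: "p \<in> Z"
      obtain h y where hy: "p = (h, y)" by fastforce
      then have h: "h \<in> carrier G" and "y \<in> X" using p assms by auto
      then obtain x where x: "x \<in> X" "y = shift_map x" using shift_image_X by blast
      \<comment> \<open>The only possible first coordinate of a preimage of
        \<open>(h, y)\<close>.\<close>
      define g where "g = h \<otimes> inv \<phi> [x 0]"
      have g: "g \<in> carrier G" "g \<otimes> \<phi> [x 0] = h"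
        using h x by (auto simp: g_def m_assoc)
      then have "(g, x) \<in> Z" using inv x p hy by metis
      then show "p \<in> skew_map G \<phi> ` Z"
        using g x hy by (force simp: skew_map_def)
    qed
  qed
qed

text \<open>This slicewise form replaces the product topology in the arguments below. If
  \<open>Z\<close> leaves \<open>carrier G \<times> X\<close>, both sides are false, since closed
  sets lie in the topological space.\<close>

lemma skew_closed_invariant_iff:
  "skew_closed_invariant Z \<longleftrightarrow>
     Z \<noteq> {} \<and> Z \<subseteq> carrier G \<times> X \<and>
     (\<forall>g\<in>carrier G. closedin (shift_topology A X) {x \<in> X. (g, x) \<in> Z}) \<and>
     (\<forall>g\<in>carrier G. \<forall>x\<in>X. (g \<otimes> \<phi> [x 0], shift_map x) \<in> Z \<longleftrightarrow> (g, x) \<in> Z)"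
proof (cases "Z \<subseteq> carrier G \<times> X")
  case True
  then show ?thesis
    by (simp add: closed_invariant_def closedin_skew_iff skew_image_eq_iff)
next
  case False
  then show ?thesis
    using closedin_subset[of "skew_topology G A X" Z] topspace_skew
    by (auto simp: closed_invariant_def)
qed

text \<open>This is the cobounding equation for the map sending a point to its fibre. It also shows
  that the fibres over \<open>x\<close> and \<open>shift_map x\<close> have equal size.\<close>

lemma fibre_shift:
  assumes Z: "skew_closed_invariant Z" and x: "x \<in> X"
  shows "{g. (g, shift_map x) \<in> Z} = {g. (g, x) \<in> Z} #> \<phi> [x 0]"
proof -
  have sub: "Z \<subseteq> carrier G \<times> X"
    and inv: "\<And>g. g \<in> carrier G \<Longrightarrow> (g \<otimes> \<phi> [x 0], shift_map x) \<in> Z \<longleftrightarrow> (g, x) \<in> Z"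
    using Z x by (auto simp: skew_closed_invariant_iff)
  show ?thesis
  proof (intro Set.set_eqI iffI)
    fix h assume "h \<in> {g. (g, shift_map x) \<in> Z}"
    then have h: "(h, shift_map x) \<in> Z" "h \<in> carrier G" using sub by auto
    define g where "g = h \<otimes> inv \<phi> [x 0]"
    have "g \<in> carrier G" "h = g \<otimes> \<phi> [x 0]" using h x by (auto simp: g_def m_assoc)
    then show "h \<in> {g. (g, x) \<in> Z} #> \<phi> [x 0]" using h inv by (auto simp: r_coset_def)
  next
    fix h assume "h \<in> {g. (g, x) \<in> Z} #> \<phi> [x 0]"
    then show "h \<in> {g. (g, shift_map x) \<in> Z}" using inv sub by (auto simp: r_coset_def)
  qed
qed

text \<open>The set of points whose fibre has at least a given size is closed and invariant, so the
  minimality of \<open>X\<close> makes the fibre size constant. Hence a closed invariant set with the fewest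
  points per fibre is minimal, and Zorn's lemma is not needed.\<close>

lemma card_fibre_const:
  assumes Z: "skew_closed_invariant Z" and x: "x \<in> X" and y: "y \<in> X"
  shows "card {g. (g, x) \<in> Z} = card {g. (g, y) \<in> Z}"
proof -
  have sub: "Z \<subseteq> carrier G \<times> X"
    and cl: "\<And>g. g \<in> carrier G \<Longrightarrow> closedin (shift_topology A X) {x \<in> X. (g, x) \<in> Z}"
    using Z by (auto simp: skew_closed_invariant_iff)
  have "card {g. (g, z) \<in> Z} \<le> card {g. (g, x) \<in> Z}" if z: "z \<in> X" and x: "x \<in> X" for x z
  proof -
    \<comment> \<open>The threshold is the fibre size over \<open>z\<close>, which puts
      \<open>z\<close> into \<open>W\<close>. Then \<open>W = X\<close> makes \<open>k\<close> a
      lower bound for all fibre sizes, and exchanging the two points gives equality.\<close>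
    define k where "k = card {g. (g, z) \<in> Z}"
    define W where "W = {x \<in> X. k \<le> card {g. (g, x) \<in> Z}}"
    \<comment> \<open>Having at least \<open>k\<close> points in the fibre means containing some
      \<open>k\<close>-element set \<open>S\<close>. This exhibits \<open>W\<close> as a finite
      union of finite intersections of closed slices.\<close>
    have W_eq: "W = (\<Union>S\<in>{S. S \<subseteq> carrier G \<and> card S = k}. {x \<in> X. \<forall>g\<in>S. (g, x) \<in> Z})"
    proof (intro Set.set_eqI iffI)
      fix x assume "x \<in> W"
      then have "x \<in> X" "k \<le> card {g. (g, x) \<in> Z}" by (simp_all add: W_def)
      moreover from this(2) obtain S where "S \<subseteq> {g. (g, x) \<in> Z}" "card S = k"
        by (rule obtain_subset_with_card_n)
      ultimately have "x \<in> X" "card S = k" "S \<subseteq> carrier G" "\<forall>g\<in>S. (g, x) \<in> Z"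
        using sub by auto
      then show "x \<in> (\<Union>S\<in>{S. S \<subseteq> carrier G \<and> card S = k}. {x \<in> X. \<forall>g\<in>S. (g, x) \<in> Z})"
        by blast
    next
      fix x assume "x \<in> (\<Union>S\<in>{S. S \<subseteq> carrier G \<and> card S = k}. {x \<in> X. \<forall>g\<in>S. (g, x) \<in> Z})"
      then obtain S where S: "card S = k" "x \<in> X" "S \<subseteq> {g. (g, x) \<in> Z}" by auto
      have "finite {g. (g, x) \<in> Z}"
        using sub by (intro finite_subset[OF _ finite_carrier]) auto
      from card_mono[OF this S(3)] show "x \<in> W" using S by (simp add: W_def)
    qed
    have "closedin (shift_topology A X) {x \<in> X. \<forall>g\<in>S. (g, x) \<in> Z}"
      if "S \<subseteq> carrier G" for S
    proof -
      have "finite S" using that finite_carrier by (rule finite_subset)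
      then show ?thesis using that
      proof (induction S)
        case empty
        show ?case using closedin_topspace[of "shift_topology A X"] by simp
      next
        case (insert g S)
        have "{x \<in> X. \<forall>g\<in>insert g S. (g, x) \<in> Z} =
            {x \<in> X. (g, x) \<in> Z} \<inter> {x \<in> X. \<forall>g\<in>S. (g, x) \<in> Z}" by auto
        then show ?case using insert cl by (simp add: closedin_Int)
      qed
    qed
    then have "closedin (shift_topology A X) W"
      unfolding W_eq using finite_carrier by (intro closedin_Union) auto
    moreover have "z \<in> W" using z by (simp add: W_def k_def)
    moreover have "shift_map x \<in> W \<longleftrightarrow> x \<in> W" if x: "x \<in> X" for x
    proof -
      have "card {g. (g, shift_map x) \<in> Z} = card ((\<lambda>g. g \<otimes> \<phi> [x 0]) ` {g. (g, x) \<in> Z})"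
        unfolding fibre_shift[OF Z x] by (simp add: r_coset_def UNION_singleton_eq_range)
      also have "\<dots> = card {g. (g, x) \<in> Z}"
      proof (rule card_image, rule inj_onI)
        fix a b assume "a \<in> {g. (g, x) \<in> Z}" "b \<in> {g. (g, x) \<in> Z}"
        then have "a \<in> carrier G" "b \<in> carrier G" using sub by auto
        then show "a \<otimes> \<phi> [x 0] = b \<otimes> \<phi> [x 0] \<Longrightarrow> a = b" using x by simp
      qed
      finally show ?thesis using x shift_X[OF x] by (simp add: W_def)
    qed
    ultimately have "W = X" by (intro shift_minimality) auto
    then show ?thesis using x unfolding W_def k_def by blast
  qed
  then show ?thesis using x y by (simp add: order_antisym)
qed

lemma ex_skew_minimal_subset:
  assumes "skew_closed_invariant Y"
  shows "\<exists>Z\<subseteq>Y. skew_minimal Z"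
proof -
  obtain x0 where x0: "x0 \<in> X" using X_nonempty by blast
  \<comment> \<open>One base point suffices for comparing sets, because the fibre size does not
    depend on it.\<close>
  define c where "c Z = card {g. (g, x0) \<in> Z}" for Z :: "('a \<times> (int \<Rightarrow> 'c)) set"
  obtain Z where Z: "skew_closed_invariant Z" "Z \<subseteq> Y"
    and least: "\<And>W. skew_closed_invariant W \<Longrightarrow> W \<subseteq> Y \<Longrightarrow> c Z \<le> c W"
    using ex_has_least_nat[of "\<lambda>Z. skew_closed_invariant Z \<and> Z \<subseteq> Y" Y c] assms by blast
  have "W = Z" if W: "skew_closed_invariant W" "W \<subseteq> Z" for W
  proof -
    have sub: "Z \<subseteq> carrier G \<times> X" using Z by (simp add: skew_closed_invariant_iff)
    have "{g. (g, x) \<in> W} = {g. (g, x) \<in> Z}" if x: "x \<in> X" for x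
    proof (rule card_seteq)
      show "finite {g. (g, x) \<in> Z}"
        using sub by (intro finite_subset[OF _ finite_carrier]) auto
      show "{g. (g, x) \<in> W} \<subseteq> {g. (g, x) \<in> Z}" using W by auto
      show "card {g. (g, x) \<in> Z} \<le> card {g. (g, x) \<in> W}"
        using least[OF W(1)] W(2) Z(2) card_fibre_const[OF Z(1) x x0] card_fibre_const[OF W(1) x x0]
        by (simp add: c_def)
    qed
    then show ?thesis using sub W(2) by (auto simp: set_eq_iff)
  qed
  then have "skew_minimal Z" using Z(1) by (simp add: minimal_closed_invariant_def)
  then show ?thesis using Z(2) by blast
qed

text \<open>Some fibre has a point, and all fibres have the same size.\<close>

lemma fibre_nonempty:
  assumes Z: "skew_closed_invariant Z" and x: "x \<in> X"
  shows "\<exists>g\<in>carrier G. (g, x) \<in> Z"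
proof -
  have sub: "Z \<subseteq> carrier G \<times> X" and "Z \<noteq> {}" using Z by (auto simp: skew_closed_invariant_iff)
  then obtain h y where hy: "(h, y) \<in> Z" "y \<in> X" by fast
  have "finite {g. (g, y) \<in> Z}"
    using sub by (intro finite_subset[OF _ finite_carrier]) auto
  then have "card {g. (g, y) \<in> Z} \<noteq> 0" using hy by auto
  then have "card {g. (g, x) \<in> Z} \<noteq> 0" using card_fibre_const[OF Z x hy(2)] by simp
  then have "{g. (g, x) \<in> Z} \<noteq> {}" by (metis card.empty)
  then show ?thesis using sub by auto
qed

text \<open>For \<open>Z\<close> inside \<open>carrier G \<times> X\<close>, the condition says that
  left translation by \<open>h\<close> maps \<open>Z\<close> onto itself. Stated as an equivalence,
  it passes directly to inverses.\<close>

definition left_stabilizer :: "('a \<times> (int \<Rightarrow> 'c)) set \<Rightarrow> 'a set" where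
  "left_stabilizer Z = {h \<in> carrier G. \<forall>a\<in>carrier G. \<forall>y. (h \<otimes> a, y) \<in> Z \<longleftrightarrow> (a, y) \<in> Z}"

lemma subgroup_left_stabilizer: "subgroup (left_stabilizer Z) G"
proof (rule subgroupI)
  show "left_stabilizer Z \<subseteq> carrier G" by (auto simp: left_stabilizer_def)
  show "left_stabilizer Z \<noteq> {}" by (auto simp: left_stabilizer_def intro!: exI[of _ \<one>])
next
  fix h assume h: "h \<in> left_stabilizer Z"
  then have hc: "h \<in> carrier G" by (simp add: left_stabilizer_def)
  have "(inv h \<otimes> a, y) \<in> Z \<longleftrightarrow> (a, y) \<in> Z" if a: "a \<in> carrier G" for a y
  proof -
    have "(h \<otimes> (inv h \<otimes> a), y) \<in> Z \<longleftrightarrow> (inv h \<otimes> a, y) \<in> Z"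
      using h a by (simp add: left_stabilizer_def)
    moreover have "h \<otimes> (inv h \<otimes> a) = a" using hc a by (simp add: m_assoc[symmetric])
    ultimately show ?thesis by simp
  qed
  then show "inv h \<in> left_stabilizer Z" using hc by (simp add: left_stabilizer_def)
next
  fix h k assume "h \<in> left_stabilizer Z" "k \<in> left_stabilizer Z"
  then show "h \<otimes> k \<in> left_stabilizer Z" by (simp add: left_stabilizer_def m_assoc)
qed

text \<open>Left translation by \<open>h = g' \<otimes> inv g\<close> commutes with the skew map.
  Hence the points of \<open>Z\<close> whose translate by \<open>h\<close> is again in
  \<open>Z\<close> form a closed invariant set. It contains \<open>(g, x)\<close>, so by minimality
  it is all of \<open>Z\<close>.\<close>

lemma skew_minimal_translate:
  assumes Z: "skew_minimal Z" and g: "(g, x) \<in> Z" "(g', x) \<in> Z" and a: "(a, y) \<in> Z"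
  shows "(g' \<otimes> inv g \<otimes> a, y) \<in> Z"
proof -
  have ci: "skew_closed_invariant Z" using Z by (simp add: minimal_closed_invariant_def)
  have sub: "Z \<subseteq> carrier G \<times> X"
    and cl: "\<And>g. g \<in> carrier G \<Longrightarrow> closedin (shift_topology A X) {x \<in> X. (g, x) \<in> Z}"
    and inv: "\<And>g x. g \<in> carrier G \<Longrightarrow> x \<in> X \<Longrightarrow>
      (g \<otimes> \<phi> [x 0], shift_map x) \<in> Z \<longleftrightarrow> (g, x) \<in> Z"
    using ci by (auto simp: skew_closed_invariant_iff)
  have gc: "g \<in> carrier G" "g' \<in> carrier G" using g sub by auto
  define h where "h = g' \<otimes> inv g"
  have h: "h \<in> carrier G" "h \<otimes> g = g'" using gc by (auto simp: h_def m_assoc)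
  define W where "W = {(b, y) \<in> Z. (h \<otimes> b, y) \<in> Z}"
  have "skew_closed_invariant W"
    unfolding skew_closed_invariant_iff
  proof (intro conjI ballI)
    have "(g, x) \<in> W" using g h by (simp add: W_def)
    then show "W \<noteq> {}" by blast
    show "W \<subseteq> carrier G \<times> X" using sub by (auto simp: W_def)
  next
    fix b assume b: "b \<in> carrier G"
    have "{x \<in> X. (b, x) \<in> W} = {x \<in> X. (b, x) \<in> Z} \<inter> {x \<in> X. (h \<otimes> b, x) \<in> Z}"
      by (auto simp: W_def)
    then show "closedin (shift_topology A X) {x \<in> X. (b, x) \<in> W}"
      using cl b h by (simp add: closedin_Int)
  next
    fix b x assume b: "b \<in> carrier G" "x \<in> X"
    then show "(b \<otimes> \<phi> [x 0], shift_map x) \<in> W \<longleftrightarrow> (b, x) \<in> W"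
      using inv[OF b] inv[of "h \<otimes> b" x] h by (simp add: W_def m_assoc)
  qed
  moreover have "W \<subseteq> Z" by (auto simp: W_def)
  ultimately have "W = Z" using Z by (simp add: minimal_closed_invariant_def)
  then show ?thesis using a unfolding W_def h_def by blast
qed

text \<open>For \<open>b\<close> and \<open>g\<close> in one fibre, translation by
  \<open>b \<otimes> inv g\<close> preserves \<open>Z\<close>. Exchanging \<open>b\<close> and
  \<open>g\<close> gives the inverse translation, so \<open>b \<otimes> inv g\<close> is in the
  stabilizer.\<close>

lemma fibre_eq_rcoset:
  assumes Z: "skew_minimal Z" and g: "(g, x) \<in> Z"
  shows "{b. (b, x) \<in> Z} = left_stabilizer Z #> g"
proof -
  have sub: "Z \<subseteq> carrier G \<times> X"
    using Z by (simp add: minimal_closed_invariant_def skew_closed_invariant_iff)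
  have gc: "g \<in> carrier G" using g sub by auto
  show ?thesis
  proof (intro Set.set_eqI iffI)
    fix b assume "b \<in> {b. (b, x) \<in> Z}"
    then have b: "(b, x) \<in> Z" "b \<in> carrier G" using sub by auto
    have "(b \<otimes> inv g \<otimes> a, y) \<in> Z \<longleftrightarrow> (a, y) \<in> Z" if a: "a \<in> carrier G" for a y
    proof
      assume "(b \<otimes> inv g \<otimes> a, y) \<in> Z"
      from skew_minimal_translate[OF Z b(1) g this]
      have "(g \<otimes> inv b \<otimes> (b \<otimes> inv g \<otimes> a), y) \<in> Z" .
      moreover have "g \<otimes> inv b \<otimes> (b \<otimes> inv g \<otimes> a) = a"
      proof -
        have "inv b \<otimes> (b \<otimes> (inv g \<otimes> a)) = inv g \<otimes> a"
          using a b gc by (simp add: m_assoc[symmetric])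
        moreover have "g \<otimes> (inv g \<otimes> a) = a" using a gc by (simp add: m_assoc[symmetric])
        ultimately show ?thesis using a b gc by (simp add: m_assoc)
      qed
      ultimately show "(a, y) \<in> Z" by simp
    qed (rule skew_minimal_translate[OF Z g b(1)])
    then have "b \<otimes> inv g \<in> left_stabilizer Z" using b gc by (simp add: left_stabilizer_def)
    then show "b \<in> left_stabilizer Z #> g"
      using subgroup.rcos_module_rev[OF subgroup_left_stabilizer is_group gc b(2)] by simp
  next
    fix b assume "b \<in> left_stabilizer Z #> g"
    then show "b \<in> {b. (b, x) \<in> Z}"
      using g gc by (auto simp: r_coset_def left_stabilizer_def)
  qed
qed

text \<open>Right cosets are disjoint or equal. This translates between level sets of coset-valued
  maps and slices of their graphs.\<close>

lemma rcoset_eq_iff: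
  assumes "subgroup K G" "C \<in> rcosets K" "g \<in> carrier G"
  shows "C = K #> g \<longleftrightarrow> g \<in> C"
proof -
  obtain x where "x \<in> carrier G" "C = K #> x" using assms(2) by (auto simp: RCOSETS_def)
  then show ?thesis
    using rcos_self[OF assms(3,1)] repr_independence[OF _ _ assms(1), of g x] by metis
qed

text \<open>The fibres are cosets of the stabilizer, and each level set of the fibre map is a slice
  of \<open>Z\<close>, hence closed. There are finitely many cosets, so preimages of all sets of
  cosets are closed and the map is continuous.\<close>

lemma cobounding_map_fibre:
  assumes Z: "skew_minimal Z"
  shows "cobounding_map G A X \<phi> (left_stabilizer Z) (\<lambda>x. {g. (g, x) \<in> Z})"
  unfolding cobounding_map_def
proof (intro conjI ballI)
  let ?S = "left_stabilizer Z" and ?b = "\<lambda>x. {g. (g, x) \<in> Z}"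
  have ci: "skew_closed_invariant Z" using Z by (simp add: minimal_closed_invariant_def)
  have cl: "\<And>g. g \<in> carrier G \<Longrightarrow> closedin (shift_topology A X) {x \<in> X. (g, x) \<in> Z}"
    using ci by (auto simp: skew_closed_invariant_iff)
  show sg: "subgroup ?S G" by (rule subgroup_left_stabilizer)
  have co: "?b x \<in> rcosets ?S" if "x \<in> X" for x
  proof -
    obtain g where "g \<in> carrier G" "(g, x) \<in> Z" using fibre_nonempty[OF ci \<open>x \<in> X\<close>] by blast
    then show ?thesis using fibre_eq_rcoset[OF Z, of g x] rcosetsI[OF subgroup.subset[OF sg], of g] by simp
  qed
  show "?b (shift_map x) = ?b x #> \<phi> [x 0]" if "x \<in> X" for x
    by (rule fibre_shift[OF ci that])
  have fin: "finite (rcosets ?S)" using finite_carrier by (simp add: RCOSETS_def)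
  have pc: "closedin (shift_topology A X) {x \<in> X. ?b x = C}" if C: "C \<in> rcosets ?S" for C
  proof -
    obtain g where g: "g \<in> carrier G" "C = ?S #> g" using C by (auto simp: RCOSETS_def)
    have "{x \<in> X. ?b x = C} = {x \<in> X. (g, x) \<in> Z}"
      using rcoset_eq_iff[OF sg co g(1)] g(2) by auto
    then show ?thesis using cl g by simp
  qed
  show "continuous_map (shift_topology A X) (discrete_topology (rcosets ?S)) ?b"
    unfolding continuous_map_closedin
  proof (intro conjI allI impI)
    show "?b \<in> topspace (shift_topology A X) \<rightarrow> topspace (discrete_topology (rcosets ?S))"
      using co by auto
    fix D assume "closedin (discrete_topology (rcosets ?S)) D"
    then have D: "D \<subseteq> rcosets ?S" by simp
    have "closedin (shift_topology A X) (\<Union>C\<in>D. {x \<in> X. ?b x = C})"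
      using D fin pc by (intro closedin_Union) (auto intro: finite_subset)
    also have "(\<Union>C\<in>D. {x \<in> X. ?b x = C}) = {x \<in> topspace (shift_topology A X). ?b x \<in> D}"
      by auto
    finally show "closedin (shift_topology A X) {x \<in> topspace (shift_topology A X). ?b x \<in> D}" .
  qed
qed

definition cobounding_graph :: "((int \<Rightarrow> 'c) \<Rightarrow> 'a set) \<Rightarrow> ('a \<times> (int \<Rightarrow> 'c)) set" where
  "cobounding_graph \<alpha> = {(g, x). x \<in> X \<and> g \<in> \<alpha> x}"

lemma cobounding_map_rcoset:
  "cobounding_map G A X \<phi> K \<alpha> \<Longrightarrow> x \<in> X \<Longrightarrow> \<alpha> x \<in> rcosets K"
  by (auto simp: cobounding_map_def continuous_map_def)

text \<open>Closedness gives closed slices of the graph, openness gives measurable level sets. The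
  set \<open>D\<close> is arbitrary, so that it can be a single coset or all sets containing a given
  \<open>g\<close>.\<close>

lemma cobounding_map_level_clopen:
  assumes "cobounding_map G A X \<phi> K \<alpha>"
  shows "openin (shift_topology A X) {x \<in> X. \<alpha> x \<in> D}"
    and "closedin (shift_topology A X) {x \<in> X. \<alpha> x \<in> D}"
proof -
  have c: "continuous_map (shift_topology A X) (discrete_topology (rcosets K)) \<alpha>"
    using assms by (simp add: cobounding_map_def)
  have e: "{x \<in> X. \<alpha> x \<in> D} = {x \<in> X. \<alpha> x \<in> D \<inter> rcosets K}"
    using cobounding_map_rcoset[OF assms] by auto
  show "openin (shift_topology A X) {x \<in> X. \<alpha> x \<in> D}"
    unfolding e using openin_continuous_map_preimage[OF c, of "D \<inter> rcosets K"] by simp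
  show "closedin (shift_topology A X) {x \<in> X. \<alpha> x \<in> D}"
    unfolding e using closedin_continuous_map_preimage[OF c, of "D \<inter> rcosets K"] by simp
qed

text \<open>The slice at \<open>g\<close> is the set where \<open>\<alpha> x\<close> contains
  \<open>g\<close>, which is closed. Invariance is the cobounding equation with the factor
  \<open>\<phi> [x 0]\<close> cancelled.\<close>

lemma skew_closed_invariant_cobounding_graph:
  assumes "cobounding_map G A X \<phi> K \<alpha>"
  shows "skew_closed_invariant (cobounding_graph \<alpha>)"
  unfolding skew_closed_invariant_iff
proof (intro conjI ballI)
  have sg: "subgroup K G" using assms by (simp add: cobounding_map_def)
  note co = cobounding_map_rcoset[OF assms]
  obtain x where x: "x \<in> X" using X_nonempty by blast
  have "\<alpha> x \<noteq> {}" using subgroup.rcosets_non_empty[OF sg co[OF x]] .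
  then show "cobounding_graph \<alpha> \<noteq> {}" using x by (auto simp: cobounding_graph_def)
  show "cobounding_graph \<alpha> \<subseteq> carrier G \<times> X"
    using subgroup.rcosets_carrier[OF sg is_group co] by (auto simp: cobounding_graph_def)
  fix g assume g: "g \<in> carrier G"
  have "{x \<in> X. (g, x) \<in> cobounding_graph \<alpha>} = {x \<in> X. \<alpha> x \<in> {C. g \<in> C}}"
    by (auto simp: cobounding_graph_def)
  then show "closedin (shift_topology A X) {x \<in> X. (g, x) \<in> cobounding_graph \<alpha>}"
    using cobounding_map_level_clopen(2)[OF assms, of "{C. g \<in> C}"] by simp
  fix x assume x: "x \<in> X"
  have "\<alpha> x \<subseteq> carrier G" using subgroup.rcosets_carrier[OF sg is_group co[OF x]] .
  moreover have "\<alpha> (shift_map x) = \<alpha> x #> \<phi> [x 0]"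
    using assms x by (simp add: cobounding_map_def)
  ultimately have "g \<otimes> \<phi> [x 0] \<in> \<alpha> (shift_map x) \<longleftrightarrow> g \<in> \<alpha> x"
    using g x by (auto simp: r_coset_def subset_iff)
  then show "(g \<otimes> \<phi> [x 0], shift_map x) \<in> cobounding_graph \<alpha> \<longleftrightarrow> (g, x) \<in> cobounding_graph \<alpha>"
    using x shift_X by (simp add: cobounding_graph_def)
qed

text \<open>A minimal \<open>Z\<close> inside the graph defines a cobounding map below
  \<open>\<alpha>\<close>. Minimality of \<open>\<alpha>\<close> makes the two maps equal, so
  \<open>Z\<close> is the whole graph.\<close>

lemma skew_minimal_cobounding_graph:
  assumes "minimal_cobounding_map G A X \<phi> K \<alpha>"
  shows "skew_minimal (cobounding_graph \<alpha>)"
proof -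
  have cb: "cobounding_map G A X \<phi> K \<alpha>" using assms by (simp add: minimal_cobounding_map_def)
  have sg: "subgroup K G" using cb by (simp add: cobounding_map_def)
  note co = cobounding_map_rcoset[OF cb]
  obtain Z where Z: "Z \<subseteq> cobounding_graph \<alpha>" "skew_minimal Z"
    using ex_skew_minimal_subset[OF skew_closed_invariant_cobounding_graph[OF cb]] by blast
  let ?S = "left_stabilizer Z" and ?b = "\<lambda>x. {g. (g, x) \<in> Z}"
  have sgS: "subgroup ?S G" by (rule subgroup_left_stabilizer)
  have cbS: "cobounding_map G A X \<phi> ?S ?b" by (rule cobounding_map_fibre[OF Z(2)])
  have ci: "skew_closed_invariant Z" using Z(2) by (simp add: minimal_closed_invariant_def)
  have "cobounding_le G X ?S ?b K \<alpha>"
    unfolding cobounding_le_def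
  proof (intro conjI ballI subsetI)
    \<comment> \<open>An element of the stabilizer moves a point of \<open>Z\<close> within its
      fibre, hence within one coset of \<open>K\<close>, so it lies in \<open>K\<close>.\<close>
    fix h assume h: "h \<in> ?S"
    obtain x where x: "x \<in> X" using X_nonempty by blast
    obtain g where g: "g \<in> carrier G" "(g, x) \<in> Z" using fibre_nonempty[OF ci x] by blast
    have hc: "h \<in> carrier G" using h sgS subgroup.mem_carrier by metis
    have "(h \<otimes> g, x) \<in> Z" using h g by (simp add: left_stabilizer_def)
    then have "h \<otimes> g \<in> \<alpha> x" "g \<in> \<alpha> x" using g Z(1) by (auto simp: cobounding_graph_def)
    then have "h \<otimes> g \<in> K #> g" using rcoset_eq_iff[OF sg co[OF x] g(1)] by simp
    then have "h \<otimes> g \<otimes> inv g \<in> K" using subgroup.rcos_module_imp[OF sg is_group g(1)] by simp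
    then show "h \<in> K" using hc g by (simp add: m_assoc)
  next
    fix g x assume g: "g \<in> carrier G" and "x \<in> {x \<in> X. ?b x = ?S #> g}"
    then have x: "x \<in> X" "g \<in> ?b x" using rcos_self[OF g sgS] by auto
    then have "g \<in> \<alpha> x" using Z(1) by (auto simp: cobounding_graph_def)
    then show "x \<in> {x \<in> X. \<alpha> x = K #> g}" using rcoset_eq_iff[OF sg co g] x by simp
  qed
  then have eq: "\<And>x. x \<in> X \<Longrightarrow> ?b x = \<alpha> x"
    using assms cbS unfolding minimal_cobounding_map_def by blast
  have "Z = cobounding_graph \<alpha>"
    using Z(1) eq by (fastforce simp: cobounding_graph_def)
  then show ?thesis using Z(2) by simp
qed

subsection \<open>The density formula\<close>

lemma factor_in_lists: "x \<in> X \<Longrightarrow> factor x i j \<in> lists A"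
  by (auto simp: factor_def X_letter)

text \<open>The letter read at step \<open>n\<close> is \<open>x (int n)\<close>, so the first
  coordinate accumulates the image of the prefix read so far.\<close>

lemma funpow_skew_map:
  assumes "g \<in> carrier G" "x \<in> X"
  shows "(skew_map G \<phi> ^^ n) (g, x) = (g \<otimes> \<phi> (factor x 0 (int n)), (shift_map ^^ n) x)"
proof (induction n)
  case 0
  then show ?case using assms by (simp add: factor_def phi_Nil)
next
  case (Suc n)
  have "\<phi> (factor x 0 (int (Suc n))) = \<phi> (factor x 0 (int n)) \<otimes> \<phi> [x (int n)]"
    unfolding factor_Suc using assms by (intro phi_append factor_in_lists) (auto simp: X_letter)
  then show ?case
    using Suc assms phi_closed[OF factor_in_lists[OF assms(2)]]
    by (simp add: skew_map_def m_assoc funpow_shift_map)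
qed

lemma funpow_shift_X: "x \<in> X \<Longrightarrow> (shift_map ^^ n) x \<in> X"
  by (induction n) (auto simp: shift_X)

lemma language_density:
  assumes mu: "ergodic_shift_measure A X \<mu>"
    and erg: "\<And>Y. skew_minimal Y \<Longrightarrow>
      ergodic_on (skew_map G \<phi>) (uniform_count_measure (carrier G) \<Otimes>\<^sub>M \<mu>) Y"
    and K: "K \<subseteq> carrier G"
    and cm: "minimal_cobounding_map G A X \<phi> H \<alpha>"
  shows "has_language_density \<mu> {w \<in> lists A. \<phi> w \<in> K}
           (1 / real (card H) *
             (\<Sum>k\<in>K. \<Sum>C\<in>rcosets H.
                measure \<mu> {x \<in> X. \<alpha> x = C} * measure \<mu> {x \<in> X. \<alpha> x = C #> k}))"
proof -
  let ?T = "skew_map G \<phi>"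
  have borel: "space \<mu> = X" "\<And>U. openin (shift_topology A X) U \<Longrightarrow> U \<in> sets \<mu>"
    using mu by (auto simp: ergodic_shift_measure_def borel_measure_on_def)
  interpret mu: prob_space \<mu>
    using mu by (simp add: ergodic_shift_measure_def ergodic_measure_def)
  define \<nu> where "\<nu> = uniform_count_measure (carrier G)"
  have carrier_ne: "carrier G \<noteq> {}" by auto
  interpret nu: prob_space \<nu>
    unfolding \<nu>_def by (rule prob_space_uniform_count_measure[OF finite_carrier carrier_ne])
  interpret pair: pair_prob_space \<nu> \<mu> ..
  have sets_nu: "sets \<nu> = Pow (carrier G)" and space_nu: "space \<nu> = carrier G"
    by (simp_all add: \<nu>_def sets_uniform_count_measure space_uniform_count_measure)
  have cb: "cobounding_map G A X \<phi> H \<alpha>" using cm by (simp add: minimal_cobounding_map_def)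
  have sg: "subgroup H G" using cb by (simp add: cobounding_map_def)
  note co = cobounding_map_rcoset[OF cb]
  have level: "{x \<in> X. \<alpha> x \<in> D} \<in> sets \<mu>" for D
    by (rule borel(2)[OF cobounding_map_level_clopen(1)[OF cb]])
  have level1: "{x \<in> X. \<alpha> x = C} \<in> sets \<mu>" for C using level[of "{C}"] by simp
  have H0: "0 < card H"
    using subgroup.one_closed[OF sg] finite_subset[OF subgroup.subset[OF sg] finite_carrier]
    unfolding card_gt_0_iff by blast
  have G0: "0 < card (carrier G)" using finite_carrier carrier_ne by (simp add: card_gt_0_iff)
  define Y where "Y = cobounding_graph \<alpha>"
  have Ysub: "Y \<subseteq> carrier G \<times> X"
    using skew_closed_invariant_cobounding_graph[OF cb] by (simp add: Y_def skew_closed_invariant_iff)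
  have rect: "{g} \<times> B \<in> sets (\<nu> \<Otimes>\<^sub>M \<mu>)" if "g \<in> carrier G" "B \<in> sets \<mu>" for g B
    using that sets_nu by (intro pair_measureI) auto
  have "(\<Union>g\<in>carrier G. {g} \<times> {x \<in> X. \<alpha> x \<in> {C. g \<in> C}}) \<in> sets (\<nu> \<Otimes>\<^sub>M \<mu>)"
    by (intro sets.finite_UN finite_carrier rect level)
  also have "(\<Union>g\<in>carrier G. {g} \<times> {x \<in> X. \<alpha> x \<in> {C. g \<in> C}}) = Y"
    using Ysub by (auto simp: Y_def cobounding_graph_def)
  finally have Ym: "Y \<in> sets (\<nu> \<Otimes>\<^sub>M \<mu>)" .
  have meas_rect: "measure (\<nu> \<Otimes>\<^sub>M \<mu>) ({g} \<times> B) = measure \<mu> B / real (card (carrier G))"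
    if "g \<in> carrier G" "B \<in> sets \<mu>" for g B
  proof -
    have "emeasure (\<nu> \<Otimes>\<^sub>M \<mu>) ({g} \<times> B) = emeasure \<nu> {g} * emeasure \<mu> B"
      using that sets_nu by (intro mu.emeasure_pair_measure_Times) auto
    then have "measure (\<nu> \<Otimes>\<^sub>M \<mu>) ({g} \<times> B) = measure \<nu> {g} * measure \<mu> B"
      by (simp add: measure_def enn2real_mult)
    also have "measure \<nu> {g} = 1 / real (card (carrier G))"
      using that(1) finite_carrier by (simp add: \<nu>_def measure_uniform_count_measure)
    finally show ?thesis by simp
  qed
  \<comment> \<open>By Fubini: every fibre of \<open>Y\<close> is a coset with \<open>card H\<close>
    elements. The mass is thus positive, and normalization makes sense.\<close>
  have "emeasure (\<nu> \<Otimes>\<^sub>M \<mu>) Y = (\<integral>\<^sup>+x. emeasure \<nu> ((\<lambda>g. (g, x)) -` Y) \<partial>\<mu>)"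
    by (rule pair.emeasure_pair_measure_alt2[OF Ym])
  also have "\<dots> = (\<integral>\<^sup>+x. ennreal (real (card H) / real (card (carrier G))) \<partial>\<mu>)"
  proof (rule nn_integral_cong)
    fix x assume "x \<in> space \<mu>"
    then have x: "x \<in> X" by (simp add: borel)
    have "(\<lambda>g. (g, x)) -` Y = \<alpha> x" using x by (auto simp: Y_def cobounding_graph_def)
    moreover have "\<alpha> x \<subseteq> carrier G" using subgroup.rcosets_carrier[OF sg is_group co[OF x]] .
    moreover have "card (\<alpha> x) = card H"
      using card_rcosets_equal[OF co[OF x] subgroup.subset[OF sg]] by simp
    ultimately show "emeasure \<nu> ((\<lambda>g. (g, x)) -` Y) = ennreal (real (card H) / real (card (carrier G)))"
      using finite_carrier by (simp add: \<nu>_def emeasure_uniform_count_measure)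
  qed
  also have "\<dots> = ennreal (real (card H) / real (card (carrier G)))"
    by (simp add: mu.emeasure_space_1)
  finally have eY: "emeasure (\<nu> \<Otimes>\<^sub>M \<mu>) Y = ennreal (real (card H) / real (card (carrier G)))" .
  have mY: "measure (\<nu> \<Otimes>\<^sub>M \<mu>) Y = real (card H) / real (card (carrier G))"
    using eY by (simp add: measure_def)
  define M where "M = uniform_measure (\<nu> \<Otimes>\<^sub>M \<mu>) Y"
  have ergM: "ergodic_measure ?T M"
    using erg[OF skew_minimal_cobounding_graph[OF cm]]
    by (simp add: M_def Y_def ergodic_on_def \<nu>_def)
  have setsM: "sets M = sets (\<nu> \<Otimes>\<^sub>M \<mu>)" and spaceM: "space M = carrier G \<times> X"
    by (simp_all add: M_def space_pair_measure space_nu borel)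
  \<comment> \<open>The slice of \<open>Y\<close> at \<open>g\<close> is the level set of
    \<open>H #> g\<close>. The factor \<open>1 / card (carrier G)\<close> cancels in the
    normalization, leaving \<open>1 / card H\<close>.\<close>
  have measM: "measure M ({g} \<times> B) = measure \<mu> (B \<inter> {x \<in> X. \<alpha> x = H #> g}) / real (card H)"
    if g: "g \<in> carrier G" and B: "B \<in> sets \<mu>" for g B
  proof -
    have e: "Y \<inter> {g} \<times> B = {g} \<times> (B \<inter> {x \<in> X. \<alpha> x = H #> g})"
      using rcoset_eq_iff[OF sg co g] by (auto simp: Y_def cobounding_graph_def)
    have "measure M ({g} \<times> B) = measure (\<nu> \<Otimes>\<^sub>M \<mu>) (Y \<inter> {g} \<times> B) / measure (\<nu> \<Otimes>\<^sub>M \<mu>) Y"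
      unfolding M_def using eY H0 G0 by (intro measure_uniform_measure rect[OF g B]) auto
    also have "\<dots> = measure \<mu> (B \<inter> {x \<in> X. \<alpha> x = H #> g}) / real (card H)"
      unfolding e mY using G0 by (subst meas_rect[OF g]) (use B level1 in auto)
    finally show ?thesis .
  qed
  define B where "B i k = {x \<in> X. \<phi> (factor x 0 (int i)) = k}" for i k
  have XS: "X \<in> sets \<mu>" using sets.top[of \<mu>] borel by simp
  \<comment> \<open>By cancellation, \<open>i\<close> steps lead from \<open>g\<close> to
    \<open>g \<otimes> k\<close> exactly when the prefix of length \<open>i\<close> has image
    \<open>k\<close>. This turns word statistics into correlations of the skew map.\<close>
  have corr: "{g} \<times> X \<inter> (?T ^^ i) -` ({g \<otimes> k} \<times> X) = {g} \<times> B i k"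
    if g: "g \<in> carrier G" and k: "k \<in> carrier G" for g k i
    using g k phi_closed[OF factor_in_lists]
    by (auto simp: B_def funpow_skew_map funpow_shift_X)
  \<comment> \<open>Ergodicity includes measurability of the skew map. Hence
    \<open>{\<one>} \<times> B i k\<close> is measurable, and \<open>B i k\<close> is its section at
    \<open>\<one>\<close>.\<close>
  have Bm: "B i k \<in> sets \<mu>" if k: "k \<in> carrier G" for i k
  proof -
    have "(?T ^^ i) -` ({\<one> \<otimes> k} \<times> X) \<inter> space M \<in> sets M"
      using rect[of "\<one> \<otimes> k" X] XS k setsM
      by (intro measurable_sets[OF funpow_measurable[OF ergodic_measure_measurable[OF ergM]]]) auto
    moreover have "{\<one>} \<times> X \<in> sets M" using rect XS setsM by simp
    ultimately have "{\<one>} \<times> X \<inter> ((?T ^^ i) -` ({\<one> \<otimes> k} \<times> X) \<inter> space M) \<in> sets M" by blast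
    also have "{\<one>} \<times> X \<inter> ((?T ^^ i) -` ({\<one> \<otimes> k} \<times> X) \<inter> space M) = {\<one>} \<times> B i k"
      using corr[of \<one> k i] k spaceM by auto
    finally have "Pair \<one> -` ({\<one>} \<times> B i k) \<in> sets \<mu>" using setsM by (intro sets_Pair1) simp
    then show ?thesis by (simp add: vimage_def)
  qed
  have lim: "(\<lambda>n. 1 / real n * (\<Sum>i<n. measure \<mu> (B i k \<inter> {x \<in> X. \<alpha> x = C})))
      \<longlonglongrightarrow> 1 / real (card H) * (measure \<mu> {x \<in> X. \<alpha> x = C} * measure \<mu> {x \<in> X. \<alpha> x = C #> k})"
    if k: "k \<in> carrier G" and C: "C \<in> rcosets H" for k C
  proof -
    obtain g where g: "g \<in> carrier G" "C = H #> g" using C by (auto simp: RCOSETS_def)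
    have gk: "g \<otimes> k \<in> carrier G" "C #> k = H #> (g \<otimes> k)"
      using g k by (simp_all add: coset_mult_assoc subgroup.subset[OF sg])
    have Xi: "X \<inter> {x \<in> X. P x} = {x \<in> X. P x}" for P by auto
    have "(\<lambda>n. 1 / real n * (\<Sum>i<n. measure M ({g} \<times> X \<inter> (?T ^^ i) -` ({g \<otimes> k} \<times> X))))
        \<longlonglongrightarrow> measure M ({g} \<times> X) * measure M ({g \<otimes> k} \<times> X)"
      using rect[OF g(1) XS] rect[OF gk(1) XS] setsM by (intro ergodic_mean_correlation[OF ergM]) auto
    then have "(\<lambda>n. 1 / real n * (\<Sum>i<n. measure \<mu> (B i k \<inter> {x \<in> X. \<alpha> x = C}) / real (card H)))
        \<longlonglongrightarrow> measure \<mu> {x \<in> X. \<alpha> x = C} / real (card H) * (measure \<mu> {x \<in> X. \<alpha> x = C #> k} / real (card H))"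
      by (simp only: corr[OF g(1) k] measM[OF g(1) Bm[OF k]] measM[OF g(1) XS] measM[OF gk(1) XS]
          g(2)[symmetric] gk(2)[symmetric] Xi)
    \<comment> \<open>The correlations carry one factor \<open>1 / card H\<close> and their limit
      carries two. Multiplication by \<open>card H\<close> leaves the single factor of the
      formula.\<close>
    from tendsto_mult_left[OF this, of "real (card H)"] show ?thesis
      using H0 by (simp add: sum_divide_distrib[symmetric])
  qed
  have fin: "finite (rcosets H)" using finite_carrier by (simp add: RCOSETS_def)
  have finK: "finite K" using K finite_carrier by (rule finite_subset)
  \<comment> \<open>The event is decomposed by the image \<open>k\<close> of the prefix and by the
    coset \<open>\<alpha> x\<close>. Both decompositions are finite, so the limits can be taken
    termwise.\<close>
  have split: "measure \<mu> {x \<in> space \<mu>. factor x 0 (int i) \<in> {w \<in> lists A. \<phi> w \<in> K}} =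
      (\<Sum>k\<in>K. \<Sum>C\<in>rcosets H. measure \<mu> (B i k \<inter> {x \<in> X. \<alpha> x = C}))" for i
  proof -
    have "{x \<in> space \<mu>. factor x 0 (int i) \<in> {w \<in> lists A. \<phi> w \<in> K}} = (\<Union>k\<in>K. B i k)"
      using factor_in_lists by (auto simp: B_def borel)
    also have "measure \<mu> \<dots> = (\<Sum>k\<in>K. measure \<mu> (B i k))"
      using Bm K by (intro mu.finite_measure_finite_Union finK)
        (auto simp: disjoint_family_on_def B_def)
    also have "\<dots> = (\<Sum>k\<in>K. \<Sum>C\<in>rcosets H. measure \<mu> (B i k \<inter> {x \<in> X. \<alpha> x = C}))"
    proof (rule sum.cong[OF refl])
      fix k assume "k \<in> K"
      then have k: "k \<in> carrier G" using K by blast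
      have "B i k = (\<Union>C\<in>rcosets H. B i k \<inter> {x \<in> X. \<alpha> x = C})"
        using co by (auto simp: B_def)
      also have "measure \<mu> \<dots> = (\<Sum>C\<in>rcosets H. measure \<mu> (B i k \<inter> {x \<in> X. \<alpha> x = C}))"
        using Bm[OF k] level1 by (intro mu.finite_measure_finite_Union fin)
          (auto simp: disjoint_family_on_def)
      finally show "measure \<mu> (B i k) = (\<Sum>C\<in>rcosets H. measure \<mu> (B i k \<inter> {x \<in> X. \<alpha> x = C}))" .
    qed
    finally show ?thesis .
  qed
  have "(\<lambda>n. \<Sum>k\<in>K. \<Sum>C\<in>rcosets H. 1 / real n * (\<Sum>i<n. measure \<mu> (B i k \<inter> {x \<in> X. \<alpha> x = C})))
      \<longlonglongrightarrow> (\<Sum>k\<in>K. \<Sum>C\<in>rcosets H. 1 / real (card H) *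
             (measure \<mu> {x \<in> X. \<alpha> x = C} * measure \<mu> {x \<in> X. \<alpha> x = C #> k}))"
    using K by (intro tendsto_sum lim) auto
  moreover have "(\<Sum>k\<in>K. \<Sum>C\<in>rcosets H. 1 / real n * (\<Sum>i<n. measure \<mu> (B i k \<inter> {x \<in> X. \<alpha> x = C})))
      = 1 / real n * (\<Sum>i<n. \<Sum>k\<in>K. \<Sum>C\<in>rcosets H. measure \<mu> (B i k \<inter> {x \<in> X. \<alpha> x = C}))" for n
  proof -
    have "(\<Sum>i<n. \<Sum>k\<in>K. \<Sum>C\<in>rcosets H. measure \<mu> (B i k \<inter> {x \<in> X. \<alpha> x = C}))
        = (\<Sum>k\<in>K. \<Sum>i<n. \<Sum>C\<in>rcosets H. measure \<mu> (B i k \<inter> {x \<in> X. \<alpha> x = C}))"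
      by (rule sum.swap)
    also have "\<dots> = (\<Sum>k\<in>K. \<Sum>C\<in>rcosets H. \<Sum>i<n. measure \<mu> (B i k \<inter> {x \<in> X. \<alpha> x = C}))"
      by (rule sum.cong[OF refl sum.swap])
    finally show ?thesis by (simp only: sum_distrib_left)
  qed
  ultimately show ?thesis
    unfolding has_language_density_def split by (simp only: sum_distrib_left)
qed

end

theorem theorem1p3:
  fixes A :: "'a set" and X :: "(int \<Rightarrow> 'a) set" and \<mu> :: "(int \<Rightarrow> 'a) measure"
    and G :: "('g, 'm) monoid_scheme" and \<phi> :: "'a list \<Rightarrow> 'g"
    and K H :: "'g set" and \<alpha> :: "(int \<Rightarrow> 'a) \<Rightarrow> 'g set"
  assumes "minimal_shift_space A X"
    and "ergodic_shift_measure A X \<mu>"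
    and "group G" and "finite (carrier G)"
    and "\<phi> \<in> epi (free_monoid A) G"
    and "\<And>Y. minimal_closed_invariant (skew_topology G A X) (skew_map G \<phi>) Y \<Longrightarrow>
           ergodic_on (skew_map G \<phi>) (uniform_count_measure (carrier G) \<Otimes>\<^sub>M \<mu>) Y"
    and "K \<subseteq> carrier G"
    and "minimal_cobounding_map G A X \<phi> H \<alpha>"
  shows "has_language_density \<mu> {w \<in> lists A. \<phi> w \<in> K}
           (1 / real (card H) *
             (\<Sum>k\<in>K. \<Sum>C\<in>rcosets\<^bsub>G\<^esub> H.
                measure \<mu> {x \<in> X. \<alpha> x = C} * measure \<mu> {x \<in> X. \<alpha> x = C #>\<^bsub>G\<^esub> k}))"
proof -
  interpret group G by fact
  interpret group_skew_product G A X \<phi>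
    using assms(1,4,5) by unfold_locales (auto simp: epi_def)
  show ?thesis by (rule language_density[OF assms(2) assms(6-8)])
qed

end
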